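(* Let $Q$ be a finite alphabet of size $q \ge 2$, $Z$ a countable set, and $\pi_q = \mathrm{lcm}(1,2,\dots,q)$. For a network $f : Q^Z \to Q^Z$ and $s \subseteq Z$, let $f^{(s)}(x) = (f_s(x), x_{Z \setminus s})$ and $f^{(s_1,\dots,s_k)} = f^{(s_k)} \circ \dots \circ f^{(s_1)}$. Call $f$ locally commutative if $f^{(i,j)} = f^{(j,i)}$ for all $i,j \in Z$, and globally commutative if $f^{(s,t)} = f^{(t,s)}$ for all $s,t \subseteq Z$. Call a map $g : Q^Z \to Q^Z$ dynamically local if $g^{\pi_q + q - 1} = g^{q-1}$ (i.e. transient length at most $q-1$ and period at most $q$). Then: (1) if $f$ is globally commutative, then $f^{(s)}$ is dynamically local for every $s \subseteq Z$; (2) if $f$ is locally commutative, then $f^{(b)}$ is dynamically local for every finite $b \subseteq Z$; (3) there exists a locally commutative network $f$ that is not dynamically local; (4) there exists a locally commutative, dynamically local network $f$ such that $f^{(s)}$ is not dynamically local for some $s \subseteq Z$.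
   Context: Automata networks $f: Q^Z \to Q^Z$ with $Q$ finite and $Z$ countable; $x_s$ denotes the restriction of $x$ to $s$.
   Formalization: Parts (3) and (4) are stated and proved for every infinite countable Z; for finite Z they are false, since by (2) with b = Z (or b = s) every locally commutative network and all its updates are dynamically local. *)

theory Defs
  imports "HOL-Library.Countable" "HOL-Library.Cardinality"
begin

type_synonym ('z, 'q) network = "('z \<Rightarrow> 'q) \<Rightarrow> ('z \<Rightarrow> 'q)"

definition update :: "('z, 'q) network \<Rightarrow> 'z set \<Rightarrow> ('z, 'q) network" where
  "update f s x = override_on x (f x) s"

(* fold applies the head of the list first, so this is
   f^(s_k) o ... o f^(s_1) for the list [s_1, ..., s_k]. *)
definition updates :: "('z, 'q) network \<Rightarrow> 'z set list \<Rightarrow> ('z, 'q) network" where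
  "updates f ss = fold (update f) ss"

definition locally_commutative :: "('z, 'q) network \<Rightarrow> bool" where
  "locally_commutative f \<longleftrightarrow> (\<forall>i j. updates f [{i}, {j}] = updates f [{j}, {i}])"

definition globally_commutative :: "('z, 'q) network \<Rightarrow> bool" where
  "globally_commutative f \<longleftrightarrow> (\<forall>s t. updates f [s, t] = updates f [t, s])"

definition lcm_upto :: "nat \<Rightarrow> nat" where
  "lcm_upto q = Lcm {1..q}"

definition dynamically_local :: "('z, 'q::finite) network \<Rightarrow> bool" where
  "dynamically_local g \<longleftrightarrow>
     g ^^ (lcm_upto CARD('q) + CARD('q) - 1) = g ^^ (CARD('q) - 1)"

end

theory Submission
  imports Defs "HOL-Library.Countable_Set"
begin

text \<open>
  Commutation of the update at \<open>i\<close> with the update on \<open>s - {i}\<close> makes \<open>f_i\<close> insensitive to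
  the latter, so that in the iterates of \<open>f^(s)\<close> the coordinate \<open>i\<close> evolves exactly as in the
  iterates of \<open>f^(i)\<close>, i.e. under a self-map of the alphabet, where the pigeonhole principle
  applies. For finite \<open>s\<close> local commutativity supplies this commutation.

  The counterexamples rely on the fact that local commutativity only constrains the behaviour of
  a network within a class of configurations differing at finitely many places: a network may
  move such classes around along an infinite orbit. In the second example, a full update
  additionally overwrites an infinite set of coordinates that marks the orbit and thereby
  leaves the orbit at once, whereas an update off this set does not.
\<close>

lemma funpow_add_period:
  fixes h :: "'a \<Rightarrow> 'a"
  assumes "(h ^^ (p + a)) x = (h ^^ a) x" "p dvd m" "a \<le> k"
  shows "(h ^^ (m + k)) x = (h ^^ k) x"
proof -
  obtain c where m: "m = c * p" using assms(2) by (metis dvd_def mult.commute)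
  have shift: "(h ^^ (n + p + a)) x = (h ^^ (n + a)) x" for n
    by (simp only: add.assoc funpow_add[of n] comp_apply assms(1))
  have "(h ^^ (n + c * p + a)) x = (h ^^ (n + a)) x" for n c
  proof (induction c)
    case (Suc c)
    then show ?case using shift[of "n + c * p"] by (simp add: ac_simps)
  qed simp
  from this[of "k - a" c] show ?thesis
    using assms(3) by (simp add: m add.commute)
qed

text \<open>Two of the iterates at times 0 to \<open>CARD('q)\<close> coincide, say at
  \<open>a < b\<close>: the transient \<open>a\<close> is at most \<open>CARD('q) - 1\<close>, and
  the period \<open>b - a\<close> divides \<open>lcm_upto CARD('q)\<close>.\<close>

lemma funpow_lcm_upto:
  fixes h :: "'q::finite \<Rightarrow> 'q"
  shows "(h ^^ (lcm_upto CARD('q) + CARD('q) - 1)) x = (h ^^ (CARD('q) - 1)) x"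
proof -
  let ?q = "CARD('q)"
  have "card ((\<lambda>n. (h ^^ n) x) ` {..?q}) \<le> ?q"
    by (rule card_mono) auto
  then have "\<not> inj_on (\<lambda>n. (h ^^ n) x) {..?q}"
    using pigeonhole[of "\<lambda>n. (h ^^ n) x" "{..?q}"] by simp
  then obtain a b where ab: "a < b" "b \<le> ?q" "(h ^^ a) x = (h ^^ b) x"
    unfolding inj_on_def by (metis atMost_iff linorder_neqE_nat)
  have "b - a dvd lcm_upto ?q"
    unfolding lcm_upto_def using ab by (intro dvd_Lcm) auto
  then have "(h ^^ (lcm_upto ?q + (?q - 1))) x = (h ^^ (?q - 1)) x"
    using ab by (subst funpow_add_period[of "b - a" a]) simp_all
  then show ?thesis by (simp add: Suc_leI)
qed

lemma update_apply: "update f s x i = (if i \<in> s then f x i else x i)"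
  by (simp add: update_def override_on_def)

lemma update_singleton: "update f {i} x = x(i := f x i)"
  by (auto simp: update_apply fun_eq_iff)

lemma updates_pair: "updates f [s, t] = update f t \<circ> update f s"
  by (simp add: updates_def)

text \<open>Coordinate \<open>i\<close> of the commutation says that the update on \<open>s\<close>
  does not affect the value of \<open>f\<close> at \<open>i\<close>.\<close>

lemma update_insert_eq_comp:
  assumes "update f {i} \<circ> update f s = update f s \<circ> update f {i}" "i \<notin> s"
  shows "update f (insert i s) = update f {i} \<circ> update f s"
proof (intro ext)
  fix x j
  have "f (update f s x) i = f x i"
    using fun_cong[OF fun_cong[OF assms(1), of x], of i] assms(2) by (simp add: update_apply)
  then show "update f (insert i s) x j = (update f {i} \<circ> update f s) x j"
    using assms(2) by (auto simp: update_apply)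
qed

text \<open>The powers of \<open>h\<close> stand outermost: with \<open>h\<close> the update on
  \<open>s - {i}\<close>, they leave coordinate \<open>i\<close> alone.\<close>

lemma funpow_comp_commute:
  assumes "g \<circ> h = h \<circ> g"
  shows "(g \<circ> h) ^^ n = (h ^^ n) \<circ> (g ^^ n)"
proof (induction n)
  case (Suc n)
  have *: "g \<circ> (h ^^ n) = (h ^^ n) \<circ> g"
    using assms by (induction n) (auto simp: fun_eq_iff)
  have "(g \<circ> h) ^^ Suc n = h \<circ> (g \<circ> (h ^^ n)) \<circ> (g ^^ n)"
    by (simp only: funpow.simps Suc.IH assms[symmetric] o_assoc)
  then show ?case unfolding * by (simp only: funpow.simps o_assoc)
qed simp

lemma update_funpow_outside: "i \<notin> s \<Longrightarrow> (update f s ^^ n) x i = x i"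
  by (induction n) (auto simp: update_apply)

lemma update_singleton_funpow:
  "(update f {i} ^^ n) x = x(i := ((\<lambda>a. f (x(i := a)) i) ^^ n) (x i))"
proof (induction n)
  case (Suc n)
  then show ?case
    by (simp only: funpow.simps comp_apply update_singleton fun_upd_same fun_upd_upd)
qed simp

lemma dynamically_local_updateI:
  fixes f :: "('z, 'q::finite) network"
  assumes "\<And>i. i \<in> s \<Longrightarrow>
    update f {i} \<circ> update f (s - {i}) = update f (s - {i}) \<circ> update f {i}"
  shows "dynamically_local (update f s)"
proof -
  have iter: "(update f s ^^ n) x i = ((\<lambda>a. f (x(i := a)) i) ^^ n) (x i)" if "i \<in> s" for n x i
  proof -
    have "update f s = update f {i} \<circ> update f (s - {i})"
      using update_insert_eq_comp[OF assms[OF that]] that by (simp add: insert_absorb)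
    then have "(update f s ^^ n) x i = (update f (s - {i}) ^^ n) ((update f {i} ^^ n) x) i"
      using funpow_comp_commute[OF assms[OF that]] by simp
    then show ?thesis
      by (simp add: update_funpow_outside update_singleton_funpow)
  qed
  show ?thesis unfolding dynamically_local_def
  proof (intro ext)
    fix x i
    show "(update f s ^^ (lcm_upto CARD('q) + CARD('q) - 1)) x i
      = (update f s ^^ (CARD('q) - 1)) x i"
      by (cases "i \<in> s") (simp_all only: iter funpow_lcm_upto update_funpow_outside not_False_eq_True)
  qed
qed

lemma locally_commutative_update_commute:
  assumes "locally_commutative f" "finite b" "i \<notin> b"
  shows "update f {i} \<circ> update f b = update f b \<circ> update f {i}"
  using assms(2,3)
proof (induction b arbitrary: i rule: finite_induct)
  case empty
  then show ?case by (simp add: update_def fun_eq_iff)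
next
  case (insert j b)
  have *: "update f {i} \<circ> update f {j} = update f {j} \<circ> update f {i}"
    using assms(1) unfolding locally_commutative_def updates_pair by blast
  \<comment> \<open>The induction hypothesis serves at \<open>j\<close> here and at \<open>i\<close>
    next, hence the generalization over \<open>i\<close>.\<close>
  have "update f (insert j b) = update f {j} \<circ> update f b"
    using insert.IH insert.hyps(2) by (intro update_insert_eq_comp)
  moreover have "update f {i} \<circ> update f b = update f b \<circ> update f {i}"
    using insert.prems by (intro insert.IH) simp
  ultimately show ?case using * by (metis comp_assoc)
qed

text \<open>Only single-coordinate changes are tested, so \<open>f x i\<close> may still depend on
  the tail behaviour of \<open>x\<close>.\<close>

lemma locally_commutativeI:
  assumes "\<And>x i j a. i \<noteq> j \<Longrightarrow> f (x(j := a)) i = f x i"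
  shows "locally_commutative f"
proof -
  have "update f {j} (update f {i} x) = update f {i} (update f {j} x)" for x i j
  proof (cases "i = j")
    case False
    then show ?thesis by (simp add: update_singleton assms fun_upd_twist)
  qed simp
  then show ?thesis by (auto simp: locally_commutative_def updates_pair)
qed

lemma not_dynamically_localI:
  fixes g :: "('z, 'q::finite) network"
  assumes "inj y" "\<And>n. g (y n) = y (Suc n)"
  shows "\<not> dynamically_local g"
proof
  assume "dynamically_local g"
  moreover have "(g ^^ n) (y 0) = y n" for n
    by (induction n) (auto simp: assms(2))
  ultimately have "y (lcm_upto CARD('q) + CARD('q) - 1) = y (CARD('q) - 1)"
    unfolding dynamically_local_def by metis
  then have "lcm_upto CARD('q) + CARD('q) - 1 = CARD('q) - 1"
    using injD[OF assms(1)] by blast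
  \<comment> \<open>A nonempty alphabet rules out truncated subtraction, so the exponents differ by
    \<open>lcm_upto CARD('q)\<close>.\<close>
  moreover have "lcm_upto CARD('q) > 0" "CARD('q) > 0"
    by (auto simp: lcm_upto_def intro!: Nat.gr0I)
  ultimately show False by linarith
qed

lemma dynamically_local_idem:
  fixes g :: "('z, 'q::finite) network"
  assumes "CARD('q) \<ge> 2" "g \<circ> g = g"
  shows "dynamically_local g"
proof -
  have "g ^^ Suc n = g" for n
    by (induction n) (simp_all only: funpow.simps comp_id assms(2))
  then have "g ^^ n = g" if "n > 0" for n
    using that by (metis Suc_pred)
  \<comment> \<open>With at least two letters both exponents are positive; exponent 0 would give the
    identity.\<close>
  then show ?thesis unfolding dynamically_local_def using assms(1) by simp
qed

definition almost_eq :: "('z \<Rightarrow> 'q) \<Rightarrow> ('z \<Rightarrow> 'q) \<Rightarrow> bool" where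
  "almost_eq x y \<longleftrightarrow> finite {z. x z \<noteq> y z}"

lemma almost_eq_upd: "almost_eq (x(j := a)) y \<longleftrightarrow> almost_eq x y"
proof -
  have "{z. (x(j := a)) z \<noteq> y z} \<subseteq> insert j {z. x z \<noteq> y z}"
    "{z. x z \<noteq> y z} \<subseteq> insert j {z. (x(j := a)) z \<noteq> y z}" by auto
  then show ?thesis unfolding almost_eq_def by (meson finite_insert finite_subset)
qed

text \<open>If the \<open>y n\<close> lie in distinct classes of \<open>almost_eq\<close>, the class
  of \<open>y n\<close> collapses to \<open>y (Suc n)\<close>; classes without any
  \<open>y n\<close> are fixed pointwise. The choice of index depends only on the class of
  \<open>x\<close>, whence local commutativity.\<close>

definition shift_net :: "(nat \<Rightarrow> 'z \<Rightarrow> 'q) \<Rightarrow> ('z, 'q) network" where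
  "shift_net y x =
     (if \<exists>n. almost_eq x (y n) then y (Suc (SOME n. almost_eq x (y n))) else x)"

lemma shift_net_upd: "i \<noteq> j \<Longrightarrow> shift_net y (x(j := a)) i = shift_net y x i"
  by (simp add: shift_net_def almost_eq_upd)

lemma shift_net_orbit:
  assumes "\<And>m n. almost_eq (y m) (y n) \<Longrightarrow> m = n"
  shows "shift_net y (y n) = y (Suc n)"
proof -
  have "almost_eq (y n) (y n)" by (simp add: almost_eq_def)
  moreover from this have "(SOME m. almost_eq (y n) (y m)) = n"
    using assms by (intro some_equality) auto
  ultimately show ?thesis by (auto simp: shift_net_def)
qed

text \<open>The blocks are the rows of pairs of naturals, carried over by an enumeration of
  \<open>'z\<close>.\<close>

lemma infinite_disjoint_blocks:
  assumes "infinite (UNIV :: 'z::countable set)"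
  obtains B :: "nat \<Rightarrow> 'z::countable set"
  where "\<And>n. infinite (B n)" "\<And>m n. m \<noteq> n \<Longrightarrow> B m \<inter> B n = {}"
proof
  let ?e = "from_nat_into (UNIV :: 'z set)"
  let ?B = "\<lambda>n. range (\<lambda>m. ?e (prod_encode (n, m)))"
  have inj: "inj ?e"
    using bij_betw_from_nat_into[of "UNIV :: 'z set"] assms by (auto simp: bij_betw_def)
  show "infinite (?B n)" for n
    by (intro range_inj_infinite injI) (auto dest!: injD[OF inj])
  show "?B m \<inter> ?B n = {}" if "m \<noteq> n" for m n
    using that by (auto dest!: injD[OF inj])
qed

theorem theorem3:
  assumes "CARD('q::finite) \<ge> 2"
  shows
    "(\<forall>f :: ('z::countable, 'q) network.
        globally_commutative f \<longrightarrow> (\<forall>s. dynamically_local (update f s))) \<and>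
     (\<forall>f :: ('z, 'q) network.
        locally_commutative f \<longrightarrow> (\<forall>b. finite b \<longrightarrow> dynamically_local (update f b))) \<and>
     (infinite (UNIV :: 'z set) \<longrightarrow>
        (\<exists>f :: ('z, 'q) network. locally_commutative f \<and> \<not> dynamically_local f)) \<and>
     (infinite (UNIV :: 'z set) \<longrightarrow>
        (\<exists>f :: ('z, 'q) network. locally_commutative f \<and> dynamically_local f \<and>
           (\<exists>s. \<not> dynamically_local (update f s))))"
proof (intro conjI allI impI)
  fix f :: "('z, 'q) network" and s
  assume "globally_commutative f"
  then show "dynamically_local (update f s)"
    by (intro dynamically_local_updateI)
      (simp add: globally_commutative_def updates_pair)
next
  fix f :: "('z, 'q) network" and b :: "'z set"
  assume "locally_commutative f" "finite b"
  then show "dynamically_local (update f b)"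
    by (intro dynamically_local_updateI locally_commutative_update_commute) auto
next
  assume inf: "infinite (UNIV :: 'z set)"
  obtain B :: "nat \<Rightarrow> 'z set"
    where B: "\<And>n. infinite (B n)" "\<And>m n. m \<noteq> n \<Longrightarrow> B m \<inter> B n = {}"
    using infinite_disjoint_blocks[OF inf] by blast
  have "\<not> (\<exists>a. (UNIV :: 'q set) = {a})"
    using assms by (auto simp flip: card_1_singleton_iff)
  then obtain a b :: 'q where ab: "a \<noteq> b" by blast
  \<comment> \<open>The index shift reserves \<open>B 0\<close> as a marker on which every
    \<open>y n\<close> is \<open>b\<close>; infinite blocks separate the classes of the
    \<open>y n\<close>.\<close>
  define y where "y n z = (if z \<in> B (Suc n) then a else b)" for n z
  have y_eq: "m = n" if "almost_eq (y m) (y n)" for m n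
  proof (rule ccontr)
    assume "m \<noteq> n"
    then have "B (Suc m) \<subseteq> {z. y m z \<noteq> y n z}"
      using B(2)[of "Suc m" "Suc n"] ab by (auto simp: y_def)
    then show False
      using that B(1) unfolding almost_eq_def by (meson finite_subset)
  qed
  then have inj: "inj y" by (auto simp: inj_def almost_eq_def)
  have y_B0: "y n z = b" if "z \<in> B 0" for n z
    using that B(2)[of 0 "Suc n"] by (auto simp: y_def)
  show "\<exists>f :: ('z, 'q) network. locally_commutative f \<and> \<not> dynamically_local f"
  proof (intro exI conjI)
    show "locally_commutative (shift_net y)"
      by (intro locally_commutativeI shift_net_upd)
    show "\<not> dynamically_local (shift_net y)"
      by (intro not_dynamically_localI[OF inj] shift_net_orbit y_eq)
  qed

  \<comment> \<open>Writing \<open>a\<close> on the marker takes every image out of the classes of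
    the \<open>y n\<close>, so \<open>shift_net y\<close> fixes it and \<open>f\<close> is
    idempotent.\<close>
  define f where "f x = override_on (shift_net y x) (\<lambda>_. a) (B 0)" for x
  have "\<not> almost_eq (f x) (y n)" for x n
  proof -
    have "B 0 \<subseteq> {z. f x z \<noteq> y n z}" using ab by (auto simp: f_def y_B0)
    then show ?thesis using B(1) unfolding almost_eq_def by (meson finite_subset)
  qed
  then have "shift_net y (f x) = f x" for x by (simp add: shift_net_def)
  then have "f (f x) = f x" for x
    by (subst f_def) (auto simp: fun_eq_iff override_on_def f_def)
  then have "dynamically_local f"
    by (intro dynamically_local_idem assms) auto
  moreover have "locally_commutative f"
    by (rule locally_commutativeI) (simp add: f_def override_on_def shift_net_upd)
  \<comment> \<open>Off the marker nothing is overwritten, and on it \<open>y n\<close> and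
    \<open>y (Suc n)\<close> agree, so this update follows the orbit.\<close>
  moreover have "update f (- B 0) (y n) = y (Suc n)" for n
    by (auto simp: fun_eq_iff update_apply f_def shift_net_orbit[OF y_eq] y_B0)
  then have "\<not> dynamically_local (update f (- B 0))"
    by (rule not_dynamically_localI[OF inj])
  ultimately show "\<exists>f :: ('z, 'q) network. locally_commutative f \<and> dynamically_local f \<and>
      (\<exists>s. \<not> dynamically_local (update f s))"
    by (intro exI conjI)
qed

end
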